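(* Let $G$ be a graph and let $(x,y,z)$ be a path of length $2$ in $G$ (that is, $x,y,z$ are distinct vertices with $xy,yz\in E(G)$). Then $$b_{\rm R}(G)\le d_G(x)+d_G(y)+d_G(z)-|N_G(y)\cap N_G(\{x,z\})|-3.$$
   Context: Graphs are finite, undirected, without loops or multiple edges; a graph is nonempty if it has at least one edge. $N_G(x)$ is the set of neighbours of $x$ and $d_G(x)=|N_G(x)|$. For a set $S$ of vertices, $N_G(S)$ is the set of vertices not in $S$ that are adjacent to at least one vertex of $S$. A Roman dominating function on $G=(V,E)$ is a function $f:V\to\{0,1,2\}$ such that every vertex $x$ with $f(x)=0$ is adjacent to at least one vertex $y$ with $f(y)=2$. Its weight is $\sum_{u\in V}f(u)$. The Roman domination number $\gamma_{\rm R}(G)$ is the minimum weight of a Roman dominating function on $G$. The Roman bondage number of a nonempty graph $G$ is $b_{\rm R}(G)=\min\{|B|: B\subseteq E(G),\ \gamma_{\rm R}(G-B)>\gamma_{\rm R}(G)\}$, with $b_{\rm R}(G)=\infty$ if no such $B$ exists; here $G-B$ is obtained from $G$ by deleting the edges in $B$ (keeping all vertices). *)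

theory Defs
  imports "HOL-Library.Extended_Real" "HOL-Library.FuncSet"
begin

text \<open>A simple graph is given by its vertex set and its set of edges, an edge being a
  two-element set of vertices. Deleting a set of edges \<open>B\<close> from the graph \<open>V\<close>, \<open>E\<close> yields the
  graph \<open>V\<close>, \<open>E - B\<close>.\<close>

definition simple_graph :: "'a set \<Rightarrow> 'a set set \<Rightarrow> bool" where
  "simple_graph V E \<longleftrightarrow> finite V \<and> (\<forall>e\<in>E. e \<subseteq> V \<and> card e = 2)"

definition neighbours :: "'a set set \<Rightarrow> 'a \<Rightarrow> 'a set" where
  "neighbours E x = {y. {x, y} \<in> E}"

definition vertex_degree :: "'a set set \<Rightarrow> 'a \<Rightarrow> nat" where
  "vertex_degree E x = card (neighbours E x)"

definition set_neighbours :: "'a set set \<Rightarrow> 'a set \<Rightarrow> 'a set" where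
  "set_neighbours E S = {y. y \<notin> S \<and> (\<exists>x\<in>S. {x, y} \<in> E)}"

definition roman_dominating :: "'a set \<Rightarrow> 'a set set \<Rightarrow> ('a \<Rightarrow> nat) \<Rightarrow> bool" where
  "roman_dominating V E f \<longleftrightarrow>
     f \<in> V \<rightarrow> {0, 1, 2} \<and> (\<forall>x\<in>V. f x = 0 \<longrightarrow> (\<exists>y\<in>V. {x, y} \<in> E \<and> f y = 2))"

text \<open>The infimum in \<^typ>\<open>nat\<close> is a minimum, as the constant function 2 is Roman dominating.\<close>

definition roman_domination_number :: "'a set \<Rightarrow> 'a set set \<Rightarrow> nat" where
  "roman_domination_number V E = Inf {(\<Sum>u\<in>V. f u) | f. roman_dominating V E f}"

text \<open>In \<^typ>\<open>enat\<close> the infimum of a nonempty set is its minimum, and that of the empty set is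
  \<open>\<infinity>\<close>.\<close>

definition roman_bondage_number :: "'a set \<Rightarrow> 'a set set \<Rightarrow> enat" where
  "roman_bondage_number V E =
     Inf {enat (card B) | B. B \<subseteq> E \<and>
       roman_domination_number V (E - B) > roman_domination_number V E}"

end

theory Submission
  imports Defs
begin

text \<open>Delete every edge at \<open>z\<close>, every edge at \<open>x\<close> except \<open>xy\<close>, and every edge from \<open>y\<close> to a
  vertex other than \<open>x\<close> that is adjacent to neither \<open>x\<close> nor \<open>z\<close>. Counting these edges star by
  star gives at most \<open>d(z) + (d(x) - 1) + (d(y) - 2 - |N(y) \<inter> N({x, z})|)\<close> of them, which is
  the claimed bound; so it remains to see that this deletion raises the Roman domination number.

  In the remaining graph \<open>z\<close> is isolated and \<open>x\<close> can only be dominated by \<open>y\<close>, so that a Roman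
  dominating function \<open>f\<close> spends at least 1 on \<open>z\<close> and, unless \<open>f y = 2\<close>, at least 1 on \<open>x\<close>.
  Whenever \<open>f x + f y \<ge> 2\<close>, a single value 2 on \<open>y\<close> serves all of \<open>x, y, z\<close> in the original
  graph and saves what \<open>f\<close> spends on \<open>z\<close>. Otherwise \<open>f x = 1\<close> and \<open>f y = 0\<close>, and the vertex
  of value 2 that dominates \<open>y\<close> was spared by the deletion, so in the original graph it is
  adjacent to \<open>x\<close> or to \<open>z\<close>, whose value may then be dropped to 0. Hence every Roman dominating
  function of the remaining graph can be turned into a cheaper one of the original graph
  (\<open>cheaper_roman_dominating\<close>).\<close>

lemma roman_domination_number_le:
  assumes "roman_dominating V E f"
  shows "roman_domination_number V E \<le> (\<Sum>u\<in>V. f u)"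
  unfolding roman_domination_number_def by (rule cInf_lower) (use assms in auto)

lemma roman_domination_number_attained:
  obtains f where "roman_dominating V E f" "roman_domination_number V E = (\<Sum>u\<in>V. f u)"
proof -
  have "roman_dominating V E (\<lambda>_. 2)"
    by (auto simp: roman_dominating_def)
  hence "{(\<Sum>u\<in>V. f u) | f. roman_dominating V E f} \<noteq> {}"
    by blast
  from Inf_nat_def1[OF this] show ?thesis
    using that unfolding roman_domination_number_def by blast
qed

lemma roman_bondage_number_le:
  assumes "B \<subseteq> E" "roman_domination_number V E < roman_domination_number V (E - B)"
  shows "roman_bondage_number V E \<le> enat (card B)"
  unfolding roman_bondage_number_def by (rule Inf_lower) (use assms in auto)

lemma finite_neighbours:
  assumes "simple_graph V E"
  shows "finite (neighbours E v)"
proof (rule finite_subset)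
  show "neighbours E v \<subseteq> V" "finite V"
    using assms by (auto simp: simple_graph_def neighbours_def)
qed

text \<open>Passing from \<open>E'\<close> to the larger edge set \<open>E\<close> saves weight at \<open>v\<close>: no vertex relies on
  \<open>v\<close> as its dominator, and an edge of \<open>E\<close> provides a dominator for \<open>v\<close> itself.\<close>

lemma roman_dominating_drop_vertex:
  assumes f: "roman_dominating V E' f" and sub: "E' \<subseteq> E"
    and v: "u \<in> V" "{v, u} \<in> E" "f u = 2" "u \<noteq> v"
    and idle: "\<And>w. {w, v} \<in> E' \<Longrightarrow> f v \<noteq> 2"
  shows "roman_dominating V E (f(v := 0))"
  unfolding roman_dominating_def
proof (intro conjI ballI impI)
  show "f(v := 0) \<in> V \<rightarrow> {0, 1, 2}"
    using f by (auto simp: roman_dominating_def Pi_iff)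
next
  fix w assume w: "w \<in> V" "(f(v := 0)) w = 0"
  show "\<exists>t\<in>V. {w, t} \<in> E \<and> (f(v := 0)) t = 2"
  proof (cases "w = v")
    case True
    thus ?thesis using v by auto
  next
    case False
    then obtain t where "t \<in> V" "{w, t} \<in> E'" "f t = 2"
      using f w by (auto simp: roman_dominating_def)
    thus ?thesis using idle[of w] sub by (intro bexI[of _ t]) auto
  qed
qed

text \<open>Here \<open>E'\<close> stands for the edges that survive the deletion. Positive weight is forced on
  \<open>z\<close>, which is isolated, and on \<open>x\<close> unless \<open>f y = 2\<close>. In \<open>E\<close> this weight can be reduced:
  by moving the weight of \<open>x\<close> and \<open>y\<close> to \<open>y\<close> if they hold at least 2 together, and otherwise
  by letting the dominator of \<open>y\<close> take over \<open>x\<close> or \<open>z\<close>, which is what \<open>shared\<close> is for.\<close>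

lemma cheaper_roman_dominating:
  assumes fin: "finite V" and V: "x \<in> V" "y \<in> V" "z \<in> V" and dist: "distinct [x, y, z]"
    and xy: "{x, y} \<in> E" and yz: "{y, z} \<in> E" and sub: "E' \<subseteq> E"
    and isolated: "\<And>u. {z, u} \<notin> E'"
    and leaf: "\<And>u. {x, u} \<in> E' \<Longrightarrow> u = y"
    and shared: "\<And>u. {y, u} \<in> E' \<Longrightarrow> u \<noteq> x \<Longrightarrow> {x, u} \<in> E \<or> {z, u} \<in> E"
    and f: "roman_dominating V E' f"
  obtains g where "roman_dominating V E g" "(\<Sum>u\<in>V. g u) < (\<Sum>u\<in>V. f u)"
proof -
  have dominated: "\<exists>u\<in>V. {v, u} \<in> E' \<and> f u = 2" if "v \<in> V" "f v = 0" for v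
    using f that by (auto simp: roman_dominating_def)
  have val: "f v \<in> {0, 1, 2}" if "v \<in> V" for v
    using f that by (auto simp: roman_dominating_def Pi_iff)
  have fz: "f z \<noteq> 0"
    using dominated[of z] isolated V by auto
  have fx: "f x \<noteq> 0 \<or> f y = 2"
    using dominated[of x] leaf V by auto
  have split: "(\<Sum>u\<in>V. h u) = h x + h y + h z + (\<Sum>u\<in>V - {x, y, z}. h u)" for h :: "'a \<Rightarrow> nat"
    using sum.subset_diff[of "{x, y, z}" V h] fin V dist by (simp add: algebra_simps)
  show thesis
  proof (cases "f y = 0 \<and> f x \<noteq> 2")
    case True
    hence fx1: "f x = 1"
      using fx val[of x] V by auto
    obtain u where u: "u \<in> V" "{y, u} \<in> E'" "f u = 2"
      using dominated[of y] True V by auto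
    have "u \<noteq> x" using u fx1 by auto
    moreover have "u \<noteq> z" using u isolated[of y] by (auto simp: insert_commute)
    ultimately obtain v where v: "v \<in> {x, z}" "{v, u} \<in> E" "u \<noteq> v"
      using shared[OF u(2)] by blast
    have "roman_dominating V E (f(v := 0))"
    proof (rule roman_dominating_drop_vertex[OF f sub u(1) v(2) u(3) v(3)])
      show "f v \<noteq> 2" if "{w, v} \<in> E'" for w
        using v(1) that isolated[of w] fx1 by (auto simp: insert_commute)
    qed
    moreover have "(\<Sum>u\<in>V. (f(v := 0)) u) < (\<Sum>u\<in>V. f u)"
    proof (rule sum_strict_mono_ex1)
      show "\<exists>u\<in>V. (f(v := 0)) u < f u"
        using v(1) V fx1 fz by (intro bexI[of _ v]) auto
    qed (use fin in auto)
    ultimately show thesis by (rule that)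
  next
    case False
    hence two: "f x + f y \<ge> 2"
      using fx val[of y] V by auto
    define g where "g = f(x := 0, y := 2, z := 0)"
    have "roman_dominating V E g"
      unfolding roman_dominating_def
    proof (intro conjI ballI impI)
      show "g \<in> V \<rightarrow> {0, 1, 2}"
        using val by (auto simp: g_def)
    next
      fix v assume v: "v \<in> V" "g v = 0"
      show "\<exists>w\<in>V. {v, w} \<in> E \<and> g w = 2"
      proof (cases "v \<in> {x, z}")
        case True
        thus ?thesis
          using V dist xy yz by (intro bexI[of _ y]) (auto simp: g_def insert_commute)
      next
        case False
        hence "v \<noteq> y" "f v = 0"
          using v dist by (auto simp: g_def split: if_splits)
        then obtain w where w: "w \<in> V" "{v, w} \<in> E'" "f w = 2"
          using dominated v by blast
        \<comment> \<open>The dominator keeps its value: neither \<open>x\<close> nor \<open>z\<close> can reach \<open>v\<close> in \<open>E'\<close>.\<close>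
        have "w \<noteq> x" "w \<noteq> z"
          using w(2) leaf[of v] isolated[of v] \<open>v \<noteq> y\<close> by (auto simp: insert_commute)
        thus ?thesis
          using w sub by (intro bexI[of _ w]) (auto simp: g_def)
      qed
    qed
    moreover have "(\<Sum>u\<in>V. g u) < (\<Sum>u\<in>V. f u)"
    proof -
      have "(\<Sum>u\<in>V - {x, y, z}. g u) = (\<Sum>u\<in>V - {x, y, z}. f u)"
        by (rule sum.cong) (auto simp: g_def)
      thus ?thesis
        using split[of g] split[of f] two fz dist by (simp add: g_def)
    qed
    ultimately show thesis by (rule that)
  qed
qed

theorem theorem5p1:
  fixes V :: "'a set" and E :: "'a set set" and x y z :: 'a
  assumes "simple_graph V E"
    and "distinct [x, y, z]"
    and "{x, y} \<in> E" and "{y, z} \<in> E"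
  shows "ereal_of_enat (roman_bondage_number V E) \<le>
    ereal (real (vertex_degree E x) + real (vertex_degree E y) + real (vertex_degree E z)
      - real (card (neighbours E y \<inter> set_neighbours E {x, z})) - 3)"
proof -
  define C where "C = neighbours E y \<inter> set_neighbours E {x, z}"
  define Bx By Bz where "Bx = (\<lambda>u. {x, u}) ` (neighbours E x - {y})"
    and "By = (\<lambda>u. {y, u}) ` (neighbours E y - (C \<union> {x, z}))"
    and "Bz = (\<lambda>u. {z, u}) ` neighbours E z"
  define B where "B = Bx \<union> By \<union> Bz"
  note fin = finite_neighbours[OF assms(1)]
  have V: "finite V" "x \<in> V" "y \<in> V" "z \<in> V"
    using assms by (auto simp: simple_graph_def)
  have B_sub: "B \<subseteq> E"
    by (auto simp: B_def Bx_def By_def Bz_def neighbours_def)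

  have nbs: "y \<in> neighbours E x" "C \<union> {x, z} \<subseteq> neighbours E y"
    using assms by (auto simp: C_def neighbours_def insert_commute)
  have "card (C \<union> {x, z}) = card C + 2"
    using assms(2) finite_subset[OF _ fin[of y], of C]
    by (subst card_Un_disjoint) (auto simp: C_def set_neighbours_def)
  hence card_y: "card By + card C + 2 \<le> vertex_degree E y"
    using card_image_le[of "neighbours E y - (C \<union> {x, z})" "\<lambda>u. {y, u}"]
      card_Diff_subset[OF finite_subset[OF nbs(2) fin] nbs(2)] card_mono[OF fin nbs(2)] fin
    unfolding By_def vertex_degree_def by simp
  have card_x: "card Bx + 1 \<le> vertex_degree E x"
    using card_image_le[of "neighbours E x - {y}" "\<lambda>u. {x, u}"]
      card_Suc_Diff1[OF fin nbs(1)] fin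
    unfolding Bx_def vertex_degree_def by simp
  have card_z: "card Bz \<le> vertex_degree E z"
    unfolding Bz_def vertex_degree_def by (rule card_image_le[OF fin])
  have "card B \<le> card Bx + card By + card Bz"
    unfolding B_def by (meson card_Un_le add_le_mono1 order_trans)
  hence card_B: "card B + card C + 3 \<le> vertex_degree E x + vertex_degree E y + vertex_degree E z"
    using card_x card_y card_z by linarith

  have "roman_domination_number V E < roman_domination_number V (E - B)"
  proof -
    obtain f where f: "roman_dominating V (E - B) f"
      "roman_domination_number V (E - B) = (\<Sum>u\<in>V. f u)"
      by (rule roman_domination_number_attained)
    have isolated: "{z, u} \<notin> E - B" for u
      by (auto simp: B_def Bz_def neighbours_def)
    have leaf: "u = y" if "{x, u} \<in> E - B" for u
      using that by (auto simp: B_def Bx_def neighbours_def)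
    have shared: "{x, u} \<in> E \<or> {z, u} \<in> E" if "{y, u} \<in> E - B" "u \<noteq> x" for u
    proof -
      have "u \<noteq> z" using isolated[of y] that by (auto simp: insert_commute)
      hence "u \<in> C" using that by (auto simp: B_def By_def neighbours_def)
      thus ?thesis by (auto simp: C_def set_neighbours_def)
    qed
    obtain g where "roman_dominating V E g" "(\<Sum>u\<in>V. g u) < (\<Sum>u\<in>V. f u)"
      using cheaper_roman_dominating[OF V assms(2-4) Diff_subset isolated leaf shared f(1)]
      by blast
    thus ?thesis
      using roman_domination_number_le[of V E g] f(2) by simp
  qed
  from roman_bondage_number_le[OF B_sub this]
  have "ereal_of_enat (roman_bondage_number V E) \<le> ereal_of_enat (enat (card B))"
    by (simp only: ereal_of_enat_le_iff)
  also have "\<dots> = ereal (real (card B))"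
    by simp
  also have "\<dots> \<le> ereal (real (vertex_degree E x) + real (vertex_degree E y)
      + real (vertex_degree E z) - real (card C) - 3)"
    using card_B by simp
  finally show ?thesis
    unfolding C_def .
qed

end
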